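(* Let $n \geq d \geq 1$ be integers, $\sigma > 0$, $x^* \in \mathbb{R}^d$, and let $D$ be an integer with $2 < D \leq n-1$. If $$\log\left(1 + \frac{\|x^*\|_2^2}{\sigma^2}\right) \leq \frac{n-D+1}{n}\log\left(\frac{n-D+1}{2e}\right),$$ then for every estimator $\widehat{\Pi}$, $$\sup_{\Pi^* \in \mathcal{P}_n} \Pr\{\mathsf{d}_{\mathsf{H}}(\widehat{\Pi}, \Pi^* ) \geq D\} \geq \frac{1}{2}.$$
   Context: $\mathcal{P}_n$ denotes the set of $n\times n$ permutation matrices, identified with permutations of $\{1,\dots,n\}$. The Hamming distance is $\mathsf{d}_{\mathsf{H}}(\pi,\pi') = \#\{i : \pi(i)\neq\pi'(i)\}$, and the distance between permutation matrices is that between the corresponding permutations. The observation model is $y = \Pi^* A x^* + w$, where $A \in \mathbb{R}^{n \times d}$ has i.i.d. standard Gaussian entries, $w \sim \mathcal{N}(0,\sigma^2 I_n)$ is independent of $A$, and $\Pi^* \in \mathcal{P}_n$ is unknown and arbitrary. An estimator is a measurable function $\widehat{\Pi} : (y,A) \mapsto \widehat{\Pi}(y,A) \in \mathcal{P}_n$. The probability is over both $A$ and $w$. Logarithms are natural. *)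

theory Defs
  imports "HOL-Probability.Probability" "HOL-Combinatorics.Permutations"
begin

definition perms :: "('n \<Rightarrow> 'n) set" where
  "perms = {\<pi>. \<pi> permutes UNIV}"

text \<open>The identification of permutations with permutation matrices:
  \<open>(perm_matrix \<pi> *v v) $ i = v $ \<pi> i\<close>. The opposite convention
  \<open>\<pi> \<mapsto> inv \<pi>\<close> leaves the Hamming distance unchanged.\<close>

definition perm_matrix :: "('n \<Rightarrow> 'n) \<Rightarrow> real ^ 'n ^ 'n" where
  "perm_matrix \<pi> = (\<chi> i j. if j = \<pi> i then 1 else 0)"

definition hamming_dist :: "('n \<Rightarrow> 'n) \<Rightarrow> ('n \<Rightarrow> 'n) \<Rightarrow> nat" where
  "hamming_dist \<pi> \<pi>' = card {i. \<pi> i \<noteq> \<pi>' i}"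

text \<open>The Lebesgue density of \<open>N(0, \<sigma>\<^sup>2 I)\<close>, for \<open>\<sigma> > 0\<close>. As with
  \<^const>\<open>normal_density\<close>, the parameter is the standard deviation.\<close>

definition isotropic_normal_density :: "real \<Rightarrow> real ^ 'n \<Rightarrow> real" where
  "isotropic_normal_density \<sigma> v =
     exp (- (norm v)\<^sup>2 / (2 * \<sigma>\<^sup>2)) / sqrt (2 * pi * \<sigma>\<^sup>2) ^ CARD('n)"

text \<open>Unlike \<^const>\<open>prob_space.indep_var\<close>, this admits random variables with different
  codomain types: the generated \<open>\<sigma>\<close>-algebras are independent. Measurability is implied,
  since \<^const>\<open>prob_space.indep_set\<close> requires both families to consist of events.\<close>

definition indep_rvs ::
  "'a measure \<Rightarrow> 'b measure \<Rightarrow> ('a \<Rightarrow> 'b) \<Rightarrow> 'c measure \<Rightarrow> ('a \<Rightarrow> 'c) \<Rightarrow> bool" where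
  "indep_rvs M N X L Y \<longleftrightarrow>
     prob_space.indep_set M (sets (vimage_algebra (space M) X N)) (sets (vimage_algebra (space M) Y L))"

end

theory Submission imports Defs begin

text \<open>
  Fano's argument for approximate recovery, carried out by change of measure instead of mutual
  information. Let \<open>\<tau>\<^sup>2 = \<parallel>x\<parallel>\<^sup>2 + \<sigma>\<^sup>2\<close> and compare the law of \<open>(y, A)\<close> under each \<open>\<pi>\<close> with the
  reference law under which \<open>y \<sim> N(0, \<tau>\<^sup>2 I)\<close> is independent of \<open>A\<close>. The log-likelihood ratio \<open>L\<close>
  is a difference of squared norms plus \<open>n ln (\<tau> / \<sigma>)\<close>, and \<open>\<tau>\<close> is chosen so that the norms cancel
  in expectation: the relative entropy is \<open>n ln (\<tau> / \<sigma>)\<close> exactly.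

  With \<open>S\<close> the event that \<open>\<pi>\<close> is recovered up to distance \<open>D - 1\<close>, integrating the tangent bound
  \<open>ln z \<le> z / 2 - 1 + ln 2\<close> at \<open>z = K\<^bsup>1\<^sub>S\<^esup> e\<^bsup>-L\<^esup>\<close> bounds \<open>ln K \<cdot> Pr S\<close> by the relative entropy plus a term
  linear in the reference probability of \<open>S\<close>. Being linear, it can be averaged over \<open>\<pi>\<close>; a Hamming
  ball of radius \<open>D - 1\<close> contains at most \<open>n! / m!\<close> permutations, where \<open>m = n - D + 1\<close>, so with
  \<open>K = m!\<close> the average of the term is at most \<open>ln 2\<close>. Stirling's bound \<open>ln m! \<ge> m (ln m - 1)\<close> finishes.
\<close>

section \<open>Counting permutations in Hamming balls, and a Stirling bound\<close>

lemma card_perms: "card (perms :: ('n::finite \<Rightarrow> 'n) set) = fact CARD('n)"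
  unfolding perms_def by (rule card_permutations) auto

text \<open>Left composition with \<open>\<rho>\<close> maps the permutations that fix
  \<open>T\<close> pointwise, i.e. those of the complement of \<open>T\<close>, bijectively onto the
  permutations agreeing with \<open>\<rho>\<close> on \<open>T\<close>.\<close>

lemma card_perms_agree:
  fixes \<rho> :: "'n::finite \<Rightarrow> 'n"
  assumes "\<rho> \<in> perms"
  shows "card {\<pi> \<in> perms. \<forall>i\<in>T. \<pi> i = \<rho> i} = fact (CARD('n) - card T)"
proof -
  have \<rho>: "\<rho> permutes UNIV" using assms by (simp add: perms_def)
  then have "inj \<rho>" by (rule permutes_inj)
  have "{\<pi> \<in> perms. \<forall>i\<in>T. \<pi> i = \<rho> i} = (\<circ>) \<rho> ` {\<tau>. \<tau> permutes - T}"
  proof (intro equalityI subsetI)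
    fix \<pi> assume "\<pi> \<in> {\<pi> \<in> perms. \<forall>i\<in>T. \<pi> i = \<rho> i}"
    then have \<pi>: "\<pi> permutes UNIV" "\<And>i. i \<in> T \<Longrightarrow> \<pi> i = \<rho> i" by (auto simp: perms_def)
    have "inv \<rho> \<circ> \<pi> permutes UNIV"
      by (intro permutes_compose \<pi> permutes_inv \<rho>)
    then have "inv \<rho> \<circ> \<pi> permutes - T"
      by (rule permutes_superset) (simp add: \<pi>(2) permutes_inverses(2)[OF \<rho>])
    moreover have "\<pi> = \<rho> \<circ> (inv \<rho> \<circ> \<pi>)"
      by (simp add: fun_eq_iff permutes_inverses(1)[OF \<rho>])
    ultimately show "\<pi> \<in> (\<circ>) \<rho> ` {\<tau>. \<tau> permutes - T}" by blast
  next
    fix \<pi> assume "\<pi> \<in> (\<circ>) \<rho> ` {\<tau>. \<tau> permutes - T}"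
    then obtain \<tau> where \<tau>: "\<tau> permutes - T" "\<pi> = \<rho> \<circ> \<tau>" by blast
    then have "\<pi> permutes UNIV"
      using permutes_compose[OF permutes_subset[OF \<tau>(1)] \<rho>] by simp
    moreover have "\<pi> i = \<rho> i" if "i \<in> T" for i
      using \<tau> that by (simp add: permutes_not_in)
    ultimately show "\<pi> \<in> {\<pi> \<in> perms. \<forall>i\<in>T. \<pi> i = \<rho> i}" by (simp add: perms_def)
  qed
  moreover have "inj_on ((\<circ>) \<rho>) S" for S :: "('n \<Rightarrow> 'n) set"
    using \<open>inj \<rho>\<close> by (auto simp: inj_on_def fun_eq_iff)
  ultimately have "card {\<pi> \<in> perms. \<forall>i\<in>T. \<pi> i = \<rho> i} = card {\<tau>. \<tau> permutes - T}"
    by (simp add: card_image)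
  also have "\<dots> = fact (CARD('n) - card T)"
    by (rule card_permutations) (auto simp: Compl_eq_Diff_UNIV card_Diff_subset)
  finally show ?thesis .
qed

text \<open>Union bound: with \<open>m = n - r\<close>, a permutation in the ball agrees with
  \<open>\<rho>\<close> on some set of exactly \<open>m\<close> points. There are
  \<open>n choose m\<close> such sets, each responsible for \<open>(n - m)!\<close> permutations,
  which makes \<open>n! / m!\<close> in all. The product form avoids division in the
  naturals.\<close>

lemma card_hamming_ball_le:
  fixes \<rho> :: "'n::finite \<Rightarrow> 'n"
  assumes \<rho>: "\<rho> \<in> perms" and r: "r \<le> CARD('n)"
  shows "card {\<pi> \<in> perms. hamming_dist \<rho> \<pi> \<le> r} * fact (CARD('n) - r) \<le> (fact CARD('n) :: nat)"
proof -
  define m where "m = CARD('n) - r"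
  define \<T> where "\<T> = {T :: 'n set. card T = m}"
  have "{\<pi> \<in> perms. hamming_dist \<rho> \<pi> \<le> r} \<subseteq> (\<Union>T\<in>\<T>. {\<pi> \<in> perms. \<forall>i\<in>T. \<pi> i = \<rho> i})"
  proof
    fix \<pi> assume \<pi>: "\<pi> \<in> {\<pi> \<in> perms. hamming_dist \<rho> \<pi> \<le> r}"
    have "{i. \<rho> i = \<pi> i} = - {i. \<rho> i \<noteq> \<pi> i}" by auto
    then have "m \<le> card {i. \<rho> i = \<pi> i}"
      using \<pi> by (simp add: Compl_eq_Diff_UNIV card_Diff_subset hamming_dist_def m_def diff_le_mono2)
    then obtain T where "T \<subseteq> {i. \<rho> i = \<pi> i}" "card T = m"
      by (meson obtain_subset_with_card_n)
    then have "T \<in> \<T>" "\<forall>i\<in>T. \<pi> i = \<rho> i" by (auto simp: \<T>_def)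
    then show "\<pi> \<in> (\<Union>T\<in>\<T>. {\<pi> \<in> perms. \<forall>i\<in>T. \<pi> i = \<rho> i})"
      using \<pi> by blast
  qed
  then have "card {\<pi> \<in> perms. hamming_dist \<rho> \<pi> \<le> r} \<le> card (\<Union>T\<in>\<T>. {\<pi> \<in> perms. \<forall>i\<in>T. \<pi> i = \<rho> i})"
    by (intro card_mono) auto
  also have "\<dots> \<le> (\<Sum>T\<in>\<T>. card {\<pi> \<in> perms. \<forall>i\<in>T. \<pi> i = \<rho> i})"
    by (intro card_UN_le) auto
  also have "\<dots> = (\<Sum>T\<in>\<T>. fact (CARD('n) - m))"
    by (intro sum.cong refl) (simp add: card_perms_agree[OF \<rho>] \<T>_def)
  also have "\<dots> = (CARD('n) choose m) * fact (CARD('n) - m)"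
    using n_subsets[of "UNIV :: 'n set" m] by (simp add: \<T>_def)
  finally have "card {\<pi> \<in> perms. hamming_dist \<rho> \<pi> \<le> r} * fact m
      \<le> fact m * fact (CARD('n) - m) * (CARD('n) choose m)"
    by (simp add: mult.commute mult.left_commute)
  also have "\<dots> = fact CARD('n)"
    by (rule binomial_fact_lemma) (simp add: m_def)
  finally show ?thesis by (simp add: m_def)
qed

text \<open>The term of index \<open>m\<close> in the exponential series at \<open>m\<close> is at
  most the whole sum, so \<open>m ^ m / m!\<close> is at most \<open>exp m\<close>; take
  logarithms.\<close>

lemma ln_fact_ge:
  assumes "m > 0"
  shows "real m * (ln (real m) - 1) \<le> ln (fact m)"
proof -
  have "real m ^ m / fact m \<le> (\<Sum>k. real m ^ k /\<^sub>R fact k)"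
    using sum_le_suminf[OF summable_exp_generic[of "real m"], of "{m}"]
    by (simp add: divide_inverse mult.commute)
  then have "real m ^ m / fact m \<le> exp (real m)" by (simp add: exp_def)
  then have "ln (real m ^ m / fact m) \<le> ln (exp (real m))"
    using assms by (subst ln_le_cancel_iff) auto
  then show ?thesis using assms by (simp add: ln_div ln_realpow algebra_simps)
qed

section \<open>The isotropic Gaussian density: factorization, total mass, second moments\<close>

lemma isotropic_normal_density_eq_prod:
  fixes v :: "real ^ 'n"
  assumes "\<sigma> > 0"
  shows "isotropic_normal_density \<sigma> v = (\<Prod>b\<in>Basis. normal_density 0 \<sigma> (v \<bullet> b))"
proof -
  have "(norm v)\<^sup>2 = (\<Sum>b\<in>Basis. (v \<bullet> b)\<^sup>2)"
    unfolding power2_norm_eq_inner by (subst euclidean_inner) (simp add: power2_eq_square)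
  then show ?thesis
    by (simp add: isotropic_normal_density_def normal_density_def prod_dividef 
      exp_sum[symmetric] sum_negf sum_divide_distrib prod_constant DIM_cart)
qed

lemma isotropic_normal_density_pos: "\<sigma> > 0 \<Longrightarrow> 0 < isotropic_normal_density \<sigma> v"
  by (simp add: isotropic_normal_density_def)

lemma isotropic_normal_density_nonneg [simp]: "0 \<le> isotropic_normal_density \<sigma> v"
  by (simp add: isotropic_normal_density_def)

lemma borel_measurable_isotropic_normal_density [measurable]:
  "isotropic_normal_density \<sigma> \<in> borel_measurable borel"
  unfolding isotropic_normal_density_def[abs_def] by measurable

lemma nn_integral_isotropic_normal_density:
  assumes "\<sigma> > 0"
  shows "(\<integral>\<^sup>+v. isotropic_normal_density \<sigma> v \<partial>(lborel :: (real ^ 'n) measure)) = 1"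
proof -
  interpret prob_space "density lborel (normal_density 0 \<sigma>)"
    using assms by (rule prob_space_normal_density)
  have 1: "(\<integral>\<^sup>+x. normal_density 0 \<sigma> x \<partial>lborel) = 1"
    using emeasure_space_1 by (simp add: emeasure_density)
  have "(\<integral>\<^sup>+v. isotropic_normal_density \<sigma> v \<partial>(lborel :: (real ^ 'n) measure)) =
      (\<integral>\<^sup>+v. (\<Prod>b\<in>Basis. ennreal (normal_density 0 \<sigma> (v \<bullet> b))) \<partial>(lborel :: (real ^ 'n) measure))"
    by (simp add: isotropic_normal_density_eq_prod[OF assms] prod_ennreal)
  also have "\<dots> = 1" by (subst nn_integral_lborel_prod) (simp_all add: 1)
  finally show ?thesis .
qed

lemma nn_integral_isotropic_normal_component:
  fixes b :: "real ^ 'n"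
  assumes "\<sigma> > 0" and b: "b \<in> Basis"
  shows "(\<integral>\<^sup>+v. isotropic_normal_density \<sigma> v * (v \<bullet> b)\<^sup>2 \<partial>lborel) = \<sigma>\<^sup>2"
proof -
  interpret prob_space "density lborel (normal_density 0 \<sigma>)"
    using assms(1) by (rule prob_space_normal_density)
  have 1: "(\<integral>\<^sup>+x. normal_density 0 \<sigma> x \<partial>lborel) = 1"
    using emeasure_space_1 by (simp add: emeasure_density)
  have 2: "(\<integral>\<^sup>+x. normal_density 0 \<sigma> x * x\<^sup>2 \<partial>lborel) = \<sigma>\<^sup>2"
    using normal_moment_even[OF assms(1), of 0 1]
    by (subst nn_integral_eq_integral) (auto simp: has_bochner_integral_iff fact_numeral)
  \<comment> \<open>The weight \<open>x\<^sup>2\<close> is attached to the factor of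
    \<open>b\<close> alone. The integrand is then still a product over \<open>Basis\<close>, and
    every other factor integrates to 1.\<close>
  define f where "f b' x = ennreal (normal_density 0 \<sigma> x * (if b' = b then x\<^sup>2 else 1))" for b' :: "real ^ 'n" and x
  have [measurable]: "f b' \<in> borel_measurable borel" for b' unfolding f_def by measurable
  have int: "integral\<^sup>N lborel (f b') = (if b' = b then ennreal (\<sigma>\<^sup>2) else 1)" for b'
    by (simp add: f_def[abs_def] 1 2)
  have "ennreal (isotropic_normal_density \<sigma> v * (v \<bullet> b)\<^sup>2) = (\<Prod>b'\<in>Basis. f b' (v \<bullet> b'))" for v
  proof -
    have "(\<Prod>b'\<in>Basis. f b' (v \<bullet> b')) = ennreal (\<Prod>b'\<in>Basis. normal_density 0 \<sigma> (v \<bullet> b') * (if b' = b then (v \<bullet> b')\<^sup>2 else 1))"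
      unfolding f_def by (rule prod_ennreal) simp
    also have "\<dots> = ennreal (isotropic_normal_density \<sigma> v * (v \<bullet> b)\<^sup>2)"
      using b by (simp add: prod.distrib prod.delta isotropic_normal_density_eq_prod[OF assms(1)])
    finally show ?thesis ..
  qed
  then have "(\<integral>\<^sup>+v. isotropic_normal_density \<sigma> v * (v \<bullet> b)\<^sup>2 \<partial>lborel) = (\<integral>\<^sup>+v. (\<Prod>b'\<in>Basis. f b' (v \<bullet> b')) \<partial>lborel)"
    by simp
  also have "\<dots> = (\<Prod>b'\<in>Basis. integral\<^sup>N lborel (f b'))"
    by (rule nn_integral_lborel_prod) auto
  also have "\<dots> = \<sigma>\<^sup>2" using b by (simp add: int prod.delta)
  finally show ?thesis .
qed


lemma nn_integral_lborel_translate: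
  fixes c :: "'a::euclidean_space"
  assumes [measurable]: "f \<in> borel_measurable borel"
  shows "(\<integral>\<^sup>+v. f (c + v) \<partial>lborel) = (\<integral>\<^sup>+v. f v \<partial>lborel)"
proof -
  have "(\<integral>\<^sup>+v. f v \<partial>lborel) = (\<integral>\<^sup>+v. f v \<partial>distr lborel borel ((+) c))"
    by (simp add: lborel_distr_plus)
  also have "\<dots> = (\<integral>\<^sup>+v. f (c + v) \<partial>lborel)"
    by (rule nn_integral_distr) measurable
  finally show ?thesis ..
qed

lemma sets_vimage_algebraI:
  "B \<in> sets N \<Longrightarrow> X -` B \<inter> S \<in> sets (vimage_algebra S X N)"
  by (auto simp: sets_vimage_algebra)

lemma borel_measurable_vec_nth [measurable (raw)]:
  assumes "f \<in> borel_measurable M"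
  shows "(\<lambda>x. f x $ i) \<in> borel_measurable M"
  using assms by (rule measurable_compose) (intro borel_measurable_continuous_onI continuous_intros)

lemma power2_norm_eq_sum_vec: "(norm v)\<^sup>2 = (\<Sum>i\<in>UNIV. (v $ i)\<^sup>2)" for v :: "real ^ 'n"
  unfolding power2_norm_eq_inner by (simp add: inner_vec_def power2_eq_square)

lemma sum_square_eq_double_sum:
  fixes f :: "'i \<Rightarrow> 'b::comm_semiring_1"
  shows "(\<Sum>i\<in>I. f i)\<^sup>2 = (\<Sum>i\<in>I. \<Sum>j\<in>I. f i * f j)"
  by (simp add: power2_eq_square sum_product)

section \<open>Independence of random variables with different codomain types\<close>

context prob_space
begin

text \<open>Independence of the generated algebras makes all preimages events, but says nothing
  about where the values lie; the two range assumptions supply that half of measurability. For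
  \<open>borel\<close> they are trivial.\<close>

lemma indep_rvs_measurable:
  assumes "indep_rvs M N X L Y" "X \<in> space M \<rightarrow> space N" "Y \<in> space M \<rightarrow> space L"
  shows "X \<in> measurable M N" "Y \<in> measurable M L"
proof -
  have ind: "indep_set (sets (vimage_algebra (space M) X N)) (sets (vimage_algebra (space M) Y L))"
    using assms(1) by (simp add: indep_rvs_def)
  show "X \<in> measurable M N"
    using indep_setD_ev1[OF ind] assms(2) by (auto simp: measurable_def intro!: sets_vimage_algebraI)
  show "Y \<in> measurable M L"
    using indep_setD_ev2[OF ind] assms(3) by (auto simp: measurable_def intro!: sets_vimage_algebraI)
qed

text \<open>Independence gives equality on rectangles, which determines the product of two
  sigma-finite measures. This opens the way to Fubini for the pair of design and noise.\<close>

lemma indep_rvs_distr_pair: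
  assumes ind: "indep_rvs M N X L Y" and [measurable]: "X \<in> measurable M N" "Y \<in> measurable M L"
  shows "distr M N X \<Otimes>\<^sub>M distr M L Y = distr M (N \<Otimes>\<^sub>M L) (\<lambda>\<omega>. (X \<omega>, Y \<omega>))"
proof (rule pair_measure_eqI)
  interpret X: prob_space "distr M N X" by (rule prob_space_distr) fact
  interpret Y: prob_space "distr M L Y" by (rule prob_space_distr) fact
  show "sigma_finite_measure (distr M N X)" "sigma_finite_measure (distr M L Y)" by unfold_locales
  show "sets (distr M N X \<Otimes>\<^sub>M distr M L Y) = sets (distr M (N \<Otimes>\<^sub>M L) (\<lambda>\<omega>. (X \<omega>, Y \<omega>)))"
    by (simp cong: sets_pair_measure_cong)
next
  fix B C assume "B \<in> sets (distr M N X)" "C \<in> sets (distr M L Y)"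
  then have [measurable]: "B \<in> sets N" "C \<in> sets L" by simp_all
  have "emeasure (distr M (N \<Otimes>\<^sub>M L) (\<lambda>\<omega>. (X \<omega>, Y \<omega>))) (B \<times> C)
      = emeasure M ((X -` B \<inter> space M) \<inter> (Y -` C \<inter> space M))"
    by (subst emeasure_distr) (auto intro!: arg_cong[where f="emeasure M"])
  also have "\<dots> = ennreal (prob (X -` B \<inter> space M) * prob (Y -` C \<inter> space M))"
    unfolding emeasure_eq_measure
    using indep_setD[OF ind[unfolded indep_rvs_def] sets_vimage_algebraI sets_vimage_algebraI, of B C] by simp
  also have "\<dots> = emeasure (distr M N X) B * emeasure (distr M L Y) C"
    by (simp add: emeasure_distr emeasure_eq_measure ennreal_mult)
  finally show "emeasure (distr M N X) B * emeasure (distr M L Y) C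
      = emeasure (distr M (N \<Otimes>\<^sub>M L) (\<lambda>\<omega>. (X \<omega>, Y \<omega>))) (B \<times> C)" ..
qed

text \<open>Functions of \<open>X\<close> and of \<open>Y\<close> generate smaller algebras, so
  independence is inherited. Once the codomains coincide, \<open>indep_var\<close> and its product
  rule for expectations apply.\<close>

lemma indep_rvs_compose:
  assumes ind: "indep_rvs M N X L Y"
    and [measurable]: "X \<in> measurable M N" "Y \<in> measurable M L"
      "f \<in> measurable N K" "g \<in> measurable L K"
  shows "indep_var K (\<lambda>\<omega>. f (X \<omega>)) K (\<lambda>\<omega>. g (Y \<omega>))"
  unfolding indep_var_eq
proof (intro conjI)
  have sub: "sigma_sets (space M) {(\<lambda>\<omega>. f (X \<omega>)) -` A \<inter> space M |A. A \<in> sets K}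
      \<subseteq> sets (vimage_algebra (space M) X N)"
    if [measurable]: "X \<in> measurable M N" "f \<in> measurable N K" for X :: "'a \<Rightarrow> 'z" and f N
  proof -
    have "(\<lambda>\<omega>. f (X \<omega>)) -` A \<inter> space M = X -` (f -` A \<inter> space N) \<inter> space M" for A
      using measurable_space[OF that(1)] by auto
    then show ?thesis
      using sets_vimage_algebraI[OF measurable_sets[OF that(2)], of _ X "space M"] sets.top[of "vimage_algebra (space M) X N"]
      by (intro sets.sigma_sets_subset') auto
  qed
  show "indep_set (sigma_sets (space M) {(\<lambda>\<omega>. f (X \<omega>)) -` A \<inter> space M |A. A \<in> sets K})
    (sigma_sets (space M) {(\<lambda>\<omega>. g (Y \<omega>)) -` A \<inter> space M |A. A \<in> sets K})"
    using ind sub[of X N f] sub[of Y L g] unfolding indep_rvs_def indep_set_def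
    by (elim indep_sets_mono_sets) (auto split: bool.split)
qed measurable

section \<open>Change of measure to a reference law\<close>

text \<open>Given \<open>X\<close>, the observation \<open>y = h X + w\<close> has at its own value
  the density of \<open>w\<close>. For \<open>\<tau> > 0\<close> the quotient is therefore the
  likelihood ratio of the reference law, with \<open>y\<close> Gaussian of deviation
  \<open>\<tau>\<close> and independent of \<open>X\<close>, against the true one. The right-hand
  side no longer involves \<open>h\<close>, which is where the unknown permutation will sit.\<close>

lemma change_of_noise:
  fixes X :: "'a \<Rightarrow> 'b" and w :: "'a \<Rightarrow> real ^ 'n"
  assumes ind: "indep_rvs M N X borel w"
    and [measurable]: "X \<in> measurable M N"
    and w: "distributed M lborel w (isotropic_normal_density \<sigma>)"
    and "\<sigma> > 0"
    and [measurable]: "h \<in> borel_measurable N" "(\<lambda>(y, a). g y a) \<in> borel_measurable (borel \<Otimes>\<^sub>M N)"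
  shows "(\<integral>\<^sup>+\<omega>. g (h (X \<omega>) + w \<omega>) (X \<omega>) *
            ennreal (isotropic_normal_density \<tau> (h (X \<omega>) + w \<omega>) / isotropic_normal_density \<sigma> (w \<omega>)) \<partial>M)
       = (\<integral>\<^sup>+\<omega>. (\<integral>\<^sup>+y. g y (X \<omega>) * ennreal (isotropic_normal_density \<tau> y) \<partial>lborel) \<partial>M)"
    (is "?L = ?R")
proof -
  have [measurable]: "w \<in> borel_measurable M"
    using distributed_measurable[OF w] by simp
  have dw: "distr M borel w = density lborel (isotropic_normal_density \<sigma>)"
    using distributed_distr_eq_density[OF w] by (simp cong: distr_cong)
  interpret X: prob_space "distr M N X" by (rule prob_space_distr) fact
  interpret w: prob_space "distr M borel w" by (rule prob_space_distr) fact
  define F where "F a v = g (h a + v) a *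
      ennreal (isotropic_normal_density \<tau> (h a + v) / isotropic_normal_density \<sigma> v)" for a v
  have [measurable]: "(\<lambda>(a, v). F a v) \<in> borel_measurable (N \<Otimes>\<^sub>M borel)"
    unfolding F_def by measurable
  have "?L = (\<integral>\<^sup>+p. (\<lambda>(a, v). F a v) p \<partial>distr M (N \<Otimes>\<^sub>M borel) (\<lambda>\<omega>. (X \<omega>, w \<omega>)))"
    by (subst nn_integral_distr) (auto simp: F_def)
  also have "\<dots> = (\<integral>\<^sup>+p. (\<lambda>(a, v). F a v) p \<partial>(distr M N X \<Otimes>\<^sub>M distr M borel w))"
    by (subst indep_rvs_distr_pair[OF ind]) auto
  also have "\<dots> = (\<integral>\<^sup>+a. (\<integral>\<^sup>+v. F a v \<partial>distr M borel w) \<partial>distr M N X)"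
    by (subst w.nn_integral_fst[symmetric]) (auto cong: measurable_cong_sets)
  also have "\<dots> = (\<integral>\<^sup>+a. (\<integral>\<^sup>+v. isotropic_normal_density \<sigma> v * F a v \<partial>lborel) \<partial>distr M N X)"
    unfolding dw by (intro nn_integral_cong nn_integral_density) auto
  \<comment> \<open>The density of \<open>w\<close> cancels the denominator. What is left depends on
    \<open>v\<close> only through \<open>h a + v\<close>, so translation invariance of
    \<open>lborel\<close> then removes \<open>h\<close>.\<close>
  also have "\<dots> = (\<integral>\<^sup>+a. (\<integral>\<^sup>+v. g (h a + v) a * ennreal (isotropic_normal_density \<tau> (h a + v)) \<partial>lborel) \<partial>distr M N X)"
  proof (intro nn_integral_cong)
    fix a v
    have "ennreal (isotropic_normal_density \<sigma> v) *
        ennreal (isotropic_normal_density \<tau> (h a + v) / isotropic_normal_density \<sigma> v)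
        = ennreal (isotropic_normal_density \<tau> (h a + v))"
      using isotropic_normal_density_pos[OF \<open>\<sigma> > 0\<close>, of v] isotropic_normal_density_nonneg[of \<tau> "h a + v"]
      by (subst ennreal_mult[symmetric]) auto
    then show "isotropic_normal_density \<sigma> v * F a v = g (h a + v) a * ennreal (isotropic_normal_density \<tau> (h a + v))"
      unfolding F_def by (metis mult.left_commute)
  qed
  also have "\<dots> = (\<integral>\<^sup>+a. (\<integral>\<^sup>+y. g y a * ennreal (isotropic_normal_density \<tau> y) \<partial>lborel) \<partial>distr M N X)"
    by (intro nn_integral_cong nn_integral_lborel_translate) measurable
  also have "\<dots> = ?R"
    by (subst nn_integral_distr) auto
  finally show ?thesis .
qed

section \<open>Second moments of the noise and of the observation\<close>

lemma isotropic_normal_component_moment: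
  fixes w :: "'a \<Rightarrow> real ^ 'n"
  assumes w: "distributed M lborel w (isotropic_normal_density \<sigma>)" and "\<sigma> > 0"
  shows "integrable M (\<lambda>\<omega>. (w \<omega> $ i)\<^sup>2)" "expectation (\<lambda>\<omega>. (w \<omega> $ i)\<^sup>2) = \<sigma>\<^sup>2"
proof -
  have [measurable]: "w \<in> borel_measurable M"
    using distributed_measurable[OF w] by simp
  have b: "axis i 1 \<in> (Basis :: (real ^ 'n) set)" by (simp add: axis_in_Basis_iff)
  have "(\<integral>\<^sup>+\<omega>. (w \<omega> \<bullet> axis i 1)\<^sup>2 \<partial>M) = (\<integral>\<^sup>+v. isotropic_normal_density \<sigma> v * ennreal ((v \<bullet> axis i 1)\<^sup>2) \<partial>lborel)"
    by (rule distributed_nn_integral[OF w, symmetric]) measurable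
  also have "\<dots> = (\<integral>\<^sup>+v. isotropic_normal_density \<sigma> v * (v \<bullet> axis i 1)\<^sup>2 \<partial>lborel)"
    using isotropic_normal_density_pos[OF \<open>\<sigma> > 0\<close>] by (simp add: ennreal_mult less_imp_le)
  also have "\<dots> = \<sigma>\<^sup>2"
    by (rule nn_integral_isotropic_normal_component[OF \<open>\<sigma> > 0\<close> b])
  finally have *: "(\<integral>\<^sup>+\<omega>. (w \<omega> $ i)\<^sup>2 \<partial>M) = \<sigma>\<^sup>2" by (simp add: inner_axis)
  show "integrable M (\<lambda>\<omega>. (w \<omega> $ i)\<^sup>2)"
    by (rule integrableI_bounded) (auto simp: *)
  show "expectation (\<lambda>\<omega>. (w \<omega> $ i)\<^sup>2) = \<sigma>\<^sup>2"
    by (subst integral_eq_nn_integral) (auto simp: *)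
qed

text \<open>Pythagoras in L2: after expanding the square, orthogonality removes the off-diagonal
  terms.\<close>

lemma orthonormal_sum_moment:
  fixes X :: "'i \<Rightarrow> 'a \<Rightarrow> real"
  assumes "finite I"
    and int: "\<And>i j. i \<in> I \<Longrightarrow> j \<in> I \<Longrightarrow> integrable M (\<lambda>\<omega>. X i \<omega> * X j \<omega>)"
    and orth: "\<And>i j. i \<in> I \<Longrightarrow> j \<in> I \<Longrightarrow> expectation (\<lambda>\<omega>. X i \<omega> * X j \<omega>) = (if i = j then 1 else 0)"
  shows "integrable M (\<lambda>\<omega>. (\<Sum>i\<in>I. X i \<omega> * c i)\<^sup>2)"
    and "expectation (\<lambda>\<omega>. (\<Sum>i\<in>I. X i \<omega> * c i)\<^sup>2) = (\<Sum>i\<in>I. (c i)\<^sup>2)"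
proof -
  have eq: "(\<Sum>i\<in>I. X i \<omega> * c i)\<^sup>2 = (\<Sum>i\<in>I. \<Sum>j\<in>I. c i * c j * (X i \<omega> * X j \<omega>))" for \<omega>
    by (simp add: sum_square_eq_double_sum algebra_simps)
  show "integrable M (\<lambda>\<omega>. (\<Sum>i\<in>I. X i \<omega> * c i)\<^sup>2)"
    unfolding eq by (intro Bochner_Integration.integrable_sum integrable_mult_right int)
  have "expectation (\<lambda>\<omega>. (\<Sum>i\<in>I. X i \<omega> * c i)\<^sup>2)
      = (\<Sum>i\<in>I. \<Sum>j\<in>I. c i * c j * (if i = j then 1 else 0))"
    unfolding eq by (simp add: Bochner_Integration.integral_sum Bochner_Integration.integrable_sum int orth cong: sum.cong)
  also have "\<dots> = (\<Sum>i\<in>I. (c i)\<^sup>2)"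
    using \<open>finite I\<close> by (simp add: mult_if_delta sum.delta power2_eq_square if_distrib cong: if_cong)
  finally show "expectation (\<lambda>\<omega>. (\<Sum>i\<in>I. X i \<omega> * c i)\<^sup>2) = (\<Sum>i\<in>I. (c i)\<^sup>2)" .
qed

lemma std_normal_integrable_square:
  assumes "distributed M lborel X std_normal_density"
  shows "integrable M X" "integrable M (\<lambda>\<omega>. (X \<omega>)\<^sup>2)" "expectation (\<lambda>\<omega>. (X \<omega>)\<^sup>2) = 1"
proof -
  show "integrable M X"
    using distributed_integrable[OF assms, of "\<lambda>x. x"] integrable_std_normal_moment[of 1] by simp
  show "integrable M (\<lambda>\<omega>. (X \<omega>)\<^sup>2)"
    using distributed_integrable[OF assms, of "\<lambda>x. x\<^sup>2"] integrable_std_normal_moment[of 2] by simp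
  show "expectation (\<lambda>\<omega>. (X \<omega>)\<^sup>2) = 1"
    using standard_normal_distributed_variance[OF assms] standard_normal_distributed_expectation[OF assms]
    by simp
qed

lemma indep_std_normal_orthonormal:
  assumes ind: "indep_vars (\<lambda>_. borel) X UNIV"
    and X: "\<And>k. distributed M lborel (X k) std_normal_density"
  shows "integrable M (\<lambda>\<omega>. X k \<omega> * X l \<omega>)"
    and "expectation (\<lambda>\<omega>. X k \<omega> * X l \<omega>) = (if k = l then 1 else 0)"
proof -
  have *: "indep_vars (\<lambda>_. borel) X {k, l}"
    using ind by (rule indep_vars_subset) simp
  have "integrable M (\<lambda>\<omega>. X k \<omega> * X l \<omega>) \<and>
      expectation (\<lambda>\<omega>. X k \<omega> * X l \<omega>) = (if k = l then 1 else 0)"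
  proof (cases "k = l")
    case True
    then show ?thesis using std_normal_integrable_square[OF X] by (simp add: power2_eq_square)
  next
    case False
    then show ?thesis
      using indep_vars_integrable[OF _ *] indep_vars_lebesgue_integral[OF _ *]
        std_normal_integrable_square(1)[OF X] standard_normal_distributed_expectation[OF X]
      by simp
  qed
  then show "integrable M (\<lambda>\<omega>. X k \<omega> * X l \<omega>)"
    and "expectation (\<lambda>\<omega>. X k \<omega> * X l \<omega>) = (if k = l then 1 else 0)" by blast+
qed

text \<open>Coordinate \<open>i\<close> of the observation is the inner product of row
  \<open>\<pi> i\<close> of \<open>A\<close> with \<open>x\<close>, of second moment
  \<open>(norm x)\<^sup>2\<close>, plus an uncorrelated noise of variance
  \<open>\<sigma>\<^sup>2\<close>. The total is the same for every \<open>\<pi>\<close>, so one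
  \<open>\<tau>\<close> serves all of them.\<close>

lemma observation_second_moment:
  fixes A :: "'a \<Rightarrow> real ^ 'd ^ 'n" and w :: "'a \<Rightarrow> real ^ 'n" and x :: "real ^ 'd"
  assumes A: "indep_vars (\<lambda>_. borel) (\<lambda>(i, j) \<omega>. A \<omega> $ i $ j) UNIV"
      "\<And>i j. distributed M lborel (\<lambda>\<omega>. A \<omega> $ i $ j) std_normal_density"
    and w: "distributed M lborel w (isotropic_normal_density \<sigma>)"
    and ind: "indep_rvs M borel A borel w"
    and "\<sigma> > 0"
  shows "integrable M (\<lambda>\<omega>. (norm (perm_matrix \<pi> *v (A \<omega> *v x) + w \<omega>))\<^sup>2)"
    and "expectation (\<lambda>\<omega>. (norm (perm_matrix \<pi> *v (A \<omega> *v x) + w \<omega>))\<^sup>2)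
      = real CARD('n) * ((norm x)\<^sup>2 + \<sigma>\<^sup>2)"
proof -
  have [measurable]: "A \<in> borel_measurable M" "w \<in> borel_measurable M"
    using indep_rvs_measurable[OF ind] by auto
  define u where "u i \<omega> = (A \<omega> *v x) $ i" for i \<omega>
  have u: "u i \<omega> = (\<Sum>j\<in>UNIV. A \<omega> $ i $ j * x $ j)" for i \<omega>
    by (simp add: u_def matrix_vector_mult_def)
  have y: "(perm_matrix \<pi> *v (A \<omega> *v x)) $ i = u (\<pi> i) \<omega>" for i \<omega>
    by (simp add: u_def perm_matrix_def matrix_vector_mult_def[of "vec_lambda _"] mult_if_delta sum.delta)
  have u2: "integrable M (\<lambda>\<omega>. (u i \<omega>)\<^sup>2)" "expectation (\<lambda>\<omega>. (u i \<omega>)\<^sup>2) = (norm x)\<^sup>2" for i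
  proof -
    have D: "distributed M lborel ((\<lambda>(i, j) \<omega>. A \<omega> $ i $ j) k) std_normal_density" for k
      using A(2) by (cases k) simp
    note orth = indep_std_normal_orthonormal[OF A(1) D, of "(i, j)" "(i, k)" for j k, simplified]
    show "integrable M (\<lambda>\<omega>. (u i \<omega>)\<^sup>2)"
      unfolding u by (rule orthonormal_sum_moment) (auto simp: orth)
    have "expectation (\<lambda>\<omega>. (u i \<omega>)\<^sup>2) = (\<Sum>j\<in>UNIV. (x $ j)\<^sup>2)"
      unfolding u by (rule orthonormal_sum_moment) (auto simp: orth)
    then show "expectation (\<lambda>\<omega>. (u i \<omega>)\<^sup>2) = (norm x)\<^sup>2"
      by (simp add: power2_norm_eq_sum_vec)
  qed
  have u1: "integrable M (u i)" "expectation (u i) = 0" for i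
    unfolding u[abs_def]
    using std_normal_integrable_square(1)[OF A(2)] standard_normal_distributed_expectation[OF A(2)]
    by (simp_all add: Bochner_Integration.integral_sum)
  note w2 = isotropic_normal_component_moment[OF w \<open>\<sigma> > 0\<close>]
  \<comment> \<open>Integrability suffices here: \<open>u\<close> has mean zero, so by independence
    the cross term has mean zero too.\<close>
  have w1: "integrable M (\<lambda>\<omega>. w \<omega> $ i)" for i
    by (rule square_integrable_imp_integrable[OF _ w2(1)]) measurable
  have uw: "integrable M (\<lambda>\<omega>. u i \<omega> * w \<omega> $ j)" "expectation (\<lambda>\<omega>. u i \<omega> * w \<omega> $ j) = 0" for i j
  proof -
    have "indep_var borel (\<lambda>\<omega>. u i \<omega>) borel (\<lambda>\<omega>. w \<omega> $ j)"
      unfolding u by (rule indep_rvs_compose[OF ind]) measurable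
    from indep_var_integrable[OF this] indep_var_lebesgue_integral[OF this]
    show "integrable M (\<lambda>\<omega>. u i \<omega> * w \<omega> $ j)" "expectation (\<lambda>\<omega>. u i \<omega> * w \<omega> $ j) = 0"
      using u1 w1 by auto
  qed
  have eq: "(norm (perm_matrix \<pi> *v (A \<omega> *v x) + w \<omega>))\<^sup>2
      = (\<Sum>i\<in>UNIV. (u (\<pi> i) \<omega>)\<^sup>2 + (2 * (u (\<pi> i) \<omega> * w \<omega> $ i) + (w \<omega> $ i)\<^sup>2))" for \<omega>
    unfolding power2_norm_eq_sum_vec by (simp add: y power2_eq_square algebra_simps)
  show "integrable M (\<lambda>\<omega>. (norm (perm_matrix \<pi> *v (A \<omega> *v x) + w \<omega>))\<^sup>2)"
    unfolding eq using u2 uw w2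
    by (intro Bochner_Integration.integrable_sum Bochner_Integration.integrable_add integrable_mult_right) auto
  show "expectation (\<lambda>\<omega>. (norm (perm_matrix \<pi> *v (A \<omega> *v x) + w \<omega>))\<^sup>2)
      = real CARD('n) * ((norm x)\<^sup>2 + \<sigma>\<^sup>2)"
    unfolding eq using u2 uw w2 by (simp add: Bochner_Integration.integral_sum Bochner_Integration.integral_add)
qed

lemma noise_second_moment:
  fixes w :: "'a \<Rightarrow> real ^ 'n"
  assumes w: "distributed M lborel w (isotropic_normal_density \<sigma>)" and "\<sigma> > 0"
  shows "integrable M (\<lambda>\<omega>. (norm (w \<omega>))\<^sup>2)"
    and "expectation (\<lambda>\<omega>. (norm (w \<omega>))\<^sup>2) = real CARD('n) * \<sigma>\<^sup>2"
proof -
  show "integrable M (\<lambda>\<omega>. (norm (w \<omega>))\<^sup>2)"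
      "expectation (\<lambda>\<omega>. (norm (w \<omega>))\<^sup>2) = real CARD('n) * \<sigma>\<^sup>2"
    unfolding power2_norm_eq_sum_vec using isotropic_normal_component_moment[OF assms] by simp_all
qed

section \<open>The Fano-type bound for a single permutation\<close>

text \<open>\<open>Z\<close> is the reference expectation of the weight \<open>K\<close> on
  \<open>S\<close> and 1 off \<open>S\<close>. Keeping it as a nonnegative integral allows a later
  exchange with the sum over permutations. Its finiteness is recorded because
  \<open>enn2real\<close> would send an infinite value to 0.\<close>

lemma success_probability_bound:
  fixes X :: "'a \<Rightarrow> 'b" and w :: "'a \<Rightarrow> real ^ 'n"
  assumes ind: "indep_rvs M N X borel w"
    and X [measurable]: "X \<in> measurable M N"
    and w: "distributed M lborel w (isotropic_normal_density \<sigma>)"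
    and pos: "\<sigma> > 0" "\<tau> > 0"
    and h [measurable]: "h \<in> borel_measurable N"
    and S [measurable]: "S \<in> sets (borel \<Otimes>\<^sub>M N)"
    and K: "K \<ge> 1"
    and int: "integrable M (\<lambda>\<omega>. (norm (h (X \<omega>) + w \<omega>))\<^sup>2)"
    and moment: "expectation (\<lambda>\<omega>. (norm (h (X \<omega>) + w \<omega>))\<^sup>2) = real CARD('n) * \<tau>\<^sup>2"
  defines "Z \<equiv> \<integral>\<^sup>+\<omega>. (\<integral>\<^sup>+y. ennreal (if (y, X \<omega>) \<in> S then K else 1) * ennreal (isotropic_normal_density \<tau> y)
                  \<partial>(lborel :: (real ^ 'n) measure)) \<partial>M"
  shows "Z < \<infinity>"
    and "ln K * prob {\<omega> \<in> space M. (h (X \<omega>) + w \<omega>, X \<omega>) \<in> S}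
      \<le> real CARD('n) * ln (\<tau> / \<sigma>) + enn2real Z / 2 - 1 + ln 2"
proof -
  have [measurable]: "w \<in> borel_measurable M"
    using distributed_measurable[OF w] by simp
  define y where "y \<omega> = h (X \<omega>) + w \<omega>" for \<omega>
  have [measurable]: "y \<in> borel_measurable M" unfolding y_def by measurable
  define E where "E = {\<omega> \<in> space M. (y \<omega>, X \<omega>) \<in> S}"
  have E [measurable]: "E \<in> events" unfolding E_def by measurable
  \<comment> \<open>The logarithm of the density of \<open>w\<close> at \<open>\<sigma>\<close> over
    that of \<open>y\<close> at \<open>\<tau>\<close>. Each quadratic term has mean
    \<open>n / 2\<close>, so they cancel in expectation.\<close>
  define L where "L \<omega> = real CARD('n) * ln (\<tau> / \<sigma>) + ((norm (y \<omega>))\<^sup>2 / (2 * \<tau>\<^sup>2) - (norm (w \<omega>))\<^sup>2 / (2 * \<sigma>\<^sup>2))" for \<omega>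
  have int_y: "integrable M (\<lambda>\<omega>. (norm (y \<omega>))\<^sup>2)" "expectation (\<lambda>\<omega>. (norm (y \<omega>))\<^sup>2) = real CARD('n) * \<tau>\<^sup>2"
    using int moment by (simp_all add: y_def)
  note int_w = noise_second_moment[OF w pos(1)]
  have L: "integrable M L" "expectation L = real CARD('n) * ln (\<tau> / \<sigma>)"
    unfolding L_def[abs_def] using int_y int_w pos by (simp_all add: prob_space)
  \<comment> \<open>By \<open>density\<close> below, \<open>ln G\<close> is \<open>ln K\<close>
    times the indicator of \<open>E\<close>, minus \<open>L\<close>; by
    \<open>change_of_noise\<close>, \<open>G\<close> has mean \<open>Z\<close>.\<close>
  define G where "G \<omega> = (if (y \<omega>, X \<omega>) \<in> S then K else 1) *
      (isotropic_normal_density \<tau> (y \<omega>) / isotropic_normal_density \<sigma> (w \<omega>))" for \<omega>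
  have [measurable]: "G \<in> borel_measurable M" unfolding G_def by measurable
  have G_nonneg: "0 \<le> G \<omega>" for \<omega> using K by (simp add: G_def)
  have "(\<integral>\<^sup>+\<omega>. G \<omega> \<partial>M) = (\<integral>\<^sup>+\<omega>. ennreal (if (h (X \<omega>) + w \<omega>, X \<omega>) \<in> S then K else 1) *
      ennreal (isotropic_normal_density \<tau> (h (X \<omega>) + w \<omega>) / isotropic_normal_density \<sigma> (w \<omega>)) \<partial>M)"
    using K by (intro nn_integral_cong) (simp add: G_def y_def flip: ennreal_mult)
  also have "\<dots> = Z"
    unfolding Z_def using ind X w pos(1) h by (rule change_of_noise) measurable
  finally have G_Z: "(\<integral>\<^sup>+\<omega>. G \<omega> \<partial>M) = Z" .
  \<comment> \<open>Replace the weight by its maximum \<open>K\<close>; the reference law has total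
    mass 1.\<close>
  have "Z \<le> (\<integral>\<^sup>+\<omega>. (\<integral>\<^sup>+y. ennreal K * ennreal (isotropic_normal_density \<tau> y) \<partial>(lborel :: (real ^ 'n) measure)) \<partial>M)"
    unfolding Z_def using K by (intro nn_integral_mono mult_right_mono) (auto intro: ennreal_leI)
  also have "\<dots> = ennreal K"
    by (simp add: nn_integral_cmult nn_integral_isotropic_normal_density[OF pos(2)] emeasure_space_1)
  finally show Z_fin: "Z < \<infinity>" by (simp add: le_less_trans)
  have G: "integrable M G" "expectation G = enn2real Z"
  proof -
    show "integrable M G"
      using Z_fin G_nonneg by (intro integrableI_bounded) (simp_all add: G_Z)
    show "expectation G = enn2real Z"
      using G_nonneg by (subst integral_eq_nn_integral) (simp_all add: G_Z)
  qed
  have density: "isotropic_normal_density \<tau> (y \<omega>) / isotropic_normal_density \<sigma> (w \<omega>) = exp (- L \<omega>)" for \<omega>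
  proof -
    have "exp (- L \<omega>) = exp (- (norm (y \<omega>))\<^sup>2 / (2 * \<tau>\<^sup>2)) / exp (- (norm (w \<omega>))\<^sup>2 / (2 * \<sigma>\<^sup>2))
        * exp (- (real CARD('n) * ln (\<tau> / \<sigma>)))"
      by (simp add: L_def flip: exp_diff exp_add)
    also have "exp (- (real CARD('n) * ln (\<tau> / \<sigma>))) = (\<sigma> / \<tau>) ^ CARD('n)"
      using pos by (simp add: exp_minus exp_of_nat_mult power_divide)
    also have "\<sigma> / \<tau> = sqrt (2 * pi * \<sigma>\<^sup>2) / sqrt (2 * pi * \<tau>\<^sup>2)"
      using pos by (simp add: real_sqrt_mult)
    finally show ?thesis
      by (simp add: isotropic_normal_density_def power_divide)
  qed
  \<comment> \<open>The tangent to \<open>ln\<close> at \<open>2\<close>, because \<open>Z\<close> averages to at most \<open>2\<close> over the permutations.\<close>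
  have ptw: "ln K * indicator E \<omega> - L \<omega> \<le> G \<omega> / 2 - 1 + ln 2" if "\<omega> \<in> space M" for \<omega>
  proof -
    have "G \<omega> = exp (ln K * indicator E \<omega> - L \<omega>)"
      unfolding diff_conv_add_uminus[of _ "L \<omega>"] exp_add
      using that K by (simp add: G_def density E_def)
    then have "G \<omega> > 0" and ln_G: "ln (G \<omega>) = ln K * indicator E \<omega> - L \<omega>" by auto
    have "ln (G \<omega>) - ln 2 = ln (G \<omega> / 2)" using \<open>G \<omega> > 0\<close> by (simp add: ln_div)
    also have "\<dots> \<le> G \<omega> / 2 - 1" using \<open>G \<omega> > 0\<close> by (intro ln_le_minus_one) simp
    finally show ?thesis by (simp add: ln_G)
  qed
  have "expectation (\<lambda>\<omega>. ln K * indicator E \<omega> - L \<omega>) \<le> expectation (\<lambda>\<omega>. G \<omega> / 2 - 1 + ln 2)"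
    using L G E ptw by (intro integral_mono) (auto intro!: integrable_real_indicator simp: emeasure_eq_measure)
  then have "ln K * prob E \<le> real CARD('n) * ln (\<tau> / \<sigma>) + enn2real Z / 2 - 1 + ln 2"
    using L G E by (simp add: prob_space emeasure_eq_measure)
  then show "ln K * prob {\<omega> \<in> space M. (h (X \<omega>) + w \<omega>, X \<omega>) \<in> S}
      \<le> real CARD('n) * ln (\<tau> / \<sigma>) + enn2real Z / 2 - 1 + ln 2"
    by (simp add: E_def y_def)
qed

end

section \<open>Averaging over the true permutation\<close>

lemma sets_Collect_count_space:
  assumes "f \<in> N \<rightarrow>\<^sub>M count_space A"
  shows "{p \<in> space N. P (f p)} \<in> sets N"
proof -
  have "{p \<in> space N. P (f p)} = f -` {a \<in> A. P a} \<inter> space N"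
    using measurable_space[OF assms] by auto
  also have "\<dots> \<in> sets N" by (rule measurable_sets[OF assms]) auto
  finally show ?thesis .
qed

text \<open>The estimate \<open>\<rho>\<close> is fixed while the truth \<open>\<pi>\<close> varies.
  The weight \<open>K\<close> is balanced against the size of the ball: the permutations inside
  contribute at most \<open>n!\<close> by \<open>card_hamming_ball_le\<close>, and those outside,
  with weight 1, at most \<open>n!\<close> as well.\<close>

lemma sum_success_weights_le:
  fixes \<rho> :: "'n::finite \<Rightarrow> 'n"
  assumes "\<rho> \<in> perms" "r \<le> CARD('n)"
  defines "K \<equiv> (fact (CARD('n) - r) :: real)"
  shows "(\<Sum>\<pi>\<in>perms. if hamming_dist \<rho> \<pi> \<le> r then K else 1) \<le> 2 * fact CARD('n)"
proof -
  let ?B = "{\<pi> \<in> perms. hamming_dist \<rho> \<pi> \<le> r}"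
  have "(\<Sum>\<pi>\<in>perms. if hamming_dist \<rho> \<pi> \<le> r then K else 1)
      = (\<Sum>\<pi>\<in>?B. K) + (\<Sum>\<pi>\<in>perms - ?B. 1)"
    by (subst sum.subset_diff[of ?B]) (auto intro!: arg_cong2[where f="(+)"] sum.cong)
  also have "\<dots> \<le> real (card ?B * fact (CARD('n) - r)) + real (card (perms :: ('n \<Rightarrow> 'n) set))"
    by (simp add: K_def card_mono)
  also have "\<dots> \<le> fact CARD('n) + fact CARD('n)"
    using of_nat_mono[OF card_hamming_ball_le[OF assms(1,2)], where 'a=real]
    by (intro add_mono) (simp_all add: card_perms)
  finally show ?thesis by simp
qed

text \<open>The reference law is the same for all \<open>\<pi>\<close>, so the sum moves inside the
  integrals. There the data, and with them the estimate, are fixed, and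
  \<open>sum_success_weights_le\<close> applies pointwise.\<close>

lemma nn_integral_success_weights_le:
  fixes est :: "(real ^ 'n) \<times> 'b \<Rightarrow> 'n \<Rightarrow> 'n" and X :: "'a \<Rightarrow> 'b"
  assumes "prob_space M"
    and X [measurable]: "X \<in> measurable M N"
    and est: "est \<in> borel \<Otimes>\<^sub>M N \<rightarrow>\<^sub>M count_space perms"
    and "\<tau> > 0" "r \<le> CARD('n)"
  defines "K \<equiv> (fact (CARD('n) - r) :: real)"
  shows "(\<Sum>\<pi>\<in>perms. \<integral>\<^sup>+\<omega>. (\<integral>\<^sup>+y. ennreal (if (y, X \<omega>) \<in> {p \<in> space (borel \<Otimes>\<^sub>M N). hamming_dist (est p) \<pi> \<le> r}
            then K else 1) * ennreal (isotropic_normal_density \<tau> y) \<partial>(lborel :: (real ^ 'n) measure)) \<partial>M)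
      \<le> ennreal (2 * fact CARD('n))"
    (is "(\<Sum>\<pi>\<in>perms. \<integral>\<^sup>+\<omega>. (\<integral>\<^sup>+y. ?f \<pi> \<omega> y * ?\<phi> y \<partial>_) \<partial>M) \<le> ?R")
proof -
  interpret prob_space M by fact
  have K: "K \<ge> 1" by (simp add: K_def)
  have S [measurable]: "{p \<in> space (borel \<Otimes>\<^sub>M N). hamming_dist (est p) \<pi> \<le> r} \<in> sets (borel \<Otimes>\<^sub>M N)" for \<pi>
    using est by (rule sets_Collect_count_space)
  have "(\<Sum>\<pi>\<in>perms. \<integral>\<^sup>+\<omega>. (\<integral>\<^sup>+y. ?f \<pi> \<omega> y * ?\<phi> y \<partial>lborel) \<partial>M)
      = (\<integral>\<^sup>+\<omega>. (\<Sum>\<pi>\<in>perms. \<integral>\<^sup>+y. ?f \<pi> \<omega> y * ?\<phi> y \<partial>lborel) \<partial>M)"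
    by (rule nn_integral_sum[symmetric]) measurable
  also have "\<dots> = (\<integral>\<^sup>+\<omega>. (\<integral>\<^sup>+y. (\<Sum>\<pi>\<in>perms. ?f \<pi> \<omega> y * ?\<phi> y) \<partial>lborel) \<partial>M)"
    by (intro nn_integral_cong nn_integral_sum[symmetric]) measurable
  also have "\<dots> \<le> (\<integral>\<^sup>+\<omega>. (\<integral>\<^sup>+y. ?R * ?\<phi> y \<partial>(lborel :: (real ^ 'n) measure)) \<partial>M)"
  proof (intro nn_integral_mono)
    fix \<omega> and y :: "real ^ 'n" assume "\<omega> \<in> space M"
    then have p: "(y, X \<omega>) \<in> space (borel \<Otimes>\<^sub>M N)"
      using measurable_space[OF X] by (simp add: space_pair_measure)
    then have "est (y, X \<omega>) \<in> perms" using measurable_space[OF est] by simp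
    then have "(\<Sum>\<pi>\<in>perms. if hamming_dist (est (y, X \<omega>)) \<pi> \<le> r then K else 1) \<le> 2 * fact CARD('n)"
      unfolding K_def using \<open>r \<le> CARD('n)\<close> by (rule sum_success_weights_le)
    then have "ennreal (\<Sum>\<pi>\<in>perms. if hamming_dist (est (y, X \<omega>)) \<pi> \<le> r then K else 1) \<le> ?R"
      by (rule ennreal_leI)
    moreover have "ennreal (\<Sum>\<pi>\<in>perms. if hamming_dist (est (y, X \<omega>)) \<pi> \<le> r then K else 1)
        = (\<Sum>\<pi>\<in>perms. ?f \<pi> \<omega> y)"
      using K p by (subst sum_ennreal[symmetric]) auto
    ultimately show "(\<Sum>\<pi>\<in>perms. ?f \<pi> \<omega> y * ?\<phi> y) \<le> ?R * ?\<phi> y"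
      by (simp add: sum_distrib_right[symmetric] mult_right_mono)
  qed
  also have "\<dots> = ?R"
    by (simp add: nn_integral_cmult nn_integral_isotropic_normal_density[OF \<open>\<tau> > 0\<close>] emeasure_space_1)
  finally show ?thesis .
qed

section \<open>The lower bound on the worst-case error\<close>

theorem theorem3:
  fixes M :: "'a measure"
    and A :: "'a \<Rightarrow> real ^ 'd ^ 'n"
    and w :: "'a \<Rightarrow> real ^ 'n"
    and x :: "real ^ 'd"
    and \<sigma> :: real
    and D :: nat
    and est :: "(real ^ 'n) \<times> (real ^ 'd ^ 'n) \<Rightarrow> ('n \<Rightarrow> 'n)"
  assumes "prob_space M"
    and "prob_space.indep_vars M (\<lambda>_. borel) (\<lambda>(i, j) \<omega>. A \<omega> $ i $ j) UNIV"
    and "\<And>i j. distributed M lborel (\<lambda>\<omega>. A \<omega> $ i $ j) std_normal_density"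
    and "distributed M lborel w (isotropic_normal_density \<sigma>)"
    and "indep_rvs M borel A borel w"
    and "CARD('d) \<le> CARD('n)"
    and "\<sigma> > 0"
    and "2 < D" and "D \<le> CARD('n) - 1"
    and "ln (1 + (norm x)\<^sup>2 / \<sigma>\<^sup>2)
           \<le> (real CARD('n) - real D + 1) / real CARD('n)
              * ln ((real CARD('n) - real D + 1) / (2 * exp 1))"
    and "est \<in> borel \<Otimes>\<^sub>M borel \<rightarrow>\<^sub>M count_space perms"
  shows "(SUP \<pi>\<in>perms. measure M {\<omega> \<in> space M.
            hamming_dist (est (perm_matrix \<pi> *v (A \<omega> *v x) + w \<omega>, A \<omega>)) \<pi> \<ge> D})
         \<ge> 1 / 2"
proof -
  interpret prob_space M by fact
  note w = assms(4) and ind = assms(5) and \<open>\<sigma> > 0\<close>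
  note est = assms(11)
  have [measurable]: "A \<in> borel_measurable M" "w \<in> borel_measurable M"
    using indep_rvs_measurable[OF ind] by auto
  define n where "n = CARD('n)"
  \<comment> \<open>Distance at least \<open>D\<close> fails exactly when the distance is at most
    \<open>D - 1\<close>. Hence \<open>m\<close> is \<open>n - D + 1\<close>, the quantity in the
    hypothesis, and \<open>D \<le> n - 1\<close> gives \<open>m \<ge> 2\<close>.\<close>
  define r where "r = D - 1"
  define m where "m = n - r"
  define K where "K = (fact m :: real)"
  \<comment> \<open>The mean square of one coordinate of the observation, as the moment condition of
    \<open>success_probability_bound\<close> demands.\<close>
  define \<tau> where "\<tau> = sqrt ((norm x)\<^sup>2 + \<sigma>\<^sup>2)"
  have n: "D \<le> n - 1" "2 < D" using assms(8,9) by (simp_all add: n_def)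
  have r: "r \<le> CARD('n)" and m: "m \<ge> 2" "real m = real n - real D + 1" and "n > 0"
    using n by (auto simp: r_def m_def n_def)
  have K: "K \<ge> 1" by (simp add: K_def)
  have \<tau>2: "\<tau>\<^sup>2 = (norm x)\<^sup>2 + \<sigma>\<^sup>2" by (simp add: \<tau>_def)
  have "\<tau> > 0" using \<open>\<sigma> > 0\<close> by (simp add: \<tau>_def add_nonneg_pos)

  define y where "y \<pi> \<omega> = perm_matrix \<pi> *v (A \<omega> *v x) + w \<omega>" for \<pi> \<omega>
  define S where "S \<pi> = {p \<in> space (borel \<Otimes>\<^sub>M borel). hamming_dist (est p) \<pi> \<le> r}" for \<pi>
  have S [measurable]: "S \<pi> \<in> sets (borel \<Otimes>\<^sub>M borel)" for \<pi>
    unfolding S_def using est by (rule sets_Collect_count_space)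
  have h [measurable]: "(\<lambda>a. perm_matrix \<pi> *v (a *v x)) \<in> borel_measurable borel" for \<pi> :: "'n \<Rightarrow> 'n"
    unfolding matrix_vector_mult_def
    by (intro borel_measurable_continuous_onI continuous_intros)
  define q where "q \<pi> = prob {\<omega> \<in> space M. (y \<pi> \<omega>, A \<omega>) \<in> S \<pi>}" for \<pi>
  define err where "err \<pi> = prob {\<omega> \<in> space M. hamming_dist (est (y \<pi> \<omega>, A \<omega>)) \<pi> \<ge> D}" for \<pi>
  have err: "err \<pi> = 1 - q \<pi>" for \<pi>
  proof -
    have "{\<omega> \<in> space M. (y \<pi> \<omega>, A \<omega>) \<in> S \<pi>} \<in> events" unfolding y_def by measurable
    moreover have "{\<omega> \<in> space M. hamming_dist (est (y \<pi> \<omega>, A \<omega>)) \<pi> \<ge> D}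
        = space M - {\<omega> \<in> space M. (y \<pi> \<omega>, A \<omega>) \<in> S \<pi>}"
      using n by (auto simp: S_def r_def space_pair_measure)
    ultimately show ?thesis by (simp add: err_def q_def prob_compl)
  qed

  define Z where "Z \<pi> = (\<integral>\<^sup>+\<omega>. (\<integral>\<^sup>+v. ennreal (if (v, A \<omega>) \<in> S \<pi> then K else 1) *
      ennreal (isotropic_normal_density \<tau> v) \<partial>(lborel :: (real ^ 'n) measure)) \<partial>M)" for \<pi>
  have q_bound: "Z \<pi> < \<infinity>"
      "ln K * q \<pi> \<le> real n * ln (\<tau> / \<sigma>) + enn2real (Z \<pi>) / 2 - 1 + ln 2" for \<pi>
  proof -
    note moment = observation_second_moment[OF assms(2,3) w ind \<open>\<sigma> > 0\<close>, of \<pi> x, folded \<tau>2]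
    note bound = success_probability_bound[OF ind _ w \<open>\<sigma> > 0\<close> \<open>\<tau> > 0\<close> h S K moment]
    show "Z \<pi> < \<infinity>" unfolding Z_def by (rule bound) measurable
    show "ln K * q \<pi> \<le> real n * ln (\<tau> / \<sigma>) + enn2real (Z \<pi>) / 2 - 1 + ln 2"
      unfolding Z_def q_def n_def y_def by (rule bound) measurable
  qed
  have "ennreal (\<Sum>\<pi>\<in>perms. enn2real (Z \<pi>)) = (\<Sum>\<pi>\<in>perms. Z \<pi>)"
    using q_bound(1) by (subst sum_ennreal[symmetric]) auto
  also have "\<dots> \<le> ennreal (2 * fact n)"
    unfolding Z_def S_def K_def m_def n_def
    by (rule nn_integral_success_weights_le[OF \<open>prob_space M\<close> _ est \<open>\<tau> > 0\<close> r]) measurable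
  finally have sum_Z: "(\<Sum>\<pi>\<in>perms. enn2real (Z \<pi>)) \<le> 2 * fact n"
    by (subst (asm) ennreal_le_iff) auto

  \<comment> \<open>The factor \<open>2\<close> in \<open>2 e\<close> pays for the summand \<open>ln 2\<close>, as \<open>m \<ge> 2\<close>.\<close>
  have "real n * ln (\<tau> / \<sigma>) + ln 2 \<le> ln K / 2"
  proof -
    have "2 * ln (\<tau> / \<sigma>) = ln ((\<tau> / \<sigma>)\<^sup>2)"
      using \<open>\<tau> > 0\<close> \<open>\<sigma> > 0\<close> by (simp add: ln_realpow)
    also have "(\<tau> / \<sigma>)\<^sup>2 = 1 + (norm x)\<^sup>2 / \<sigma>\<^sup>2"
      using \<open>\<sigma> > 0\<close> by (simp add: \<tau>2 power_divide add_divide_distrib)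
    also have "ln \<dots> \<le> real m / real n * ln (real m / (2 * exp 1))"
      using assms(10) by (simp add: m n_def)
    finally have "real n * (2 * ln (\<tau> / \<sigma>)) \<le> real m * ln (real m / (2 * exp 1))"
      using \<open>n > 0\<close> by (simp add: field_simps)
    also have "\<dots> = real m * (ln (real m) - 1) - real m * ln 2"
      using m(1) by (simp add: ln_div ln_mult algebra_simps)
    also have "\<dots> \<le> ln K - 2 * ln 2"
      using ln_fact_ge[of m] m(1) by (intro diff_mono mult_right_mono) (auto simp: K_def)
    finally show ?thesis by simp
  qed
  then have "ln K * q \<pi> \<le> ln K / 2 + enn2real (Z \<pi>) / 2 - 1" for \<pi>
    using q_bound(2)[of \<pi>] by linarith
  then have "(\<Sum>\<pi>\<in>perms. ln K * q \<pi>) \<le> (\<Sum>\<pi>\<in>perms. ln K / 2 + enn2real (Z \<pi>) / 2 - 1)"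
    by (rule sum_mono)
  also have "\<dots> = fact n * (ln K / 2) + (\<Sum>\<pi>\<in>perms. enn2real (Z \<pi>)) / 2 - fact n"
    by (simp add: sum.distrib sum_subtractf sum_divide_distrib card_perms n_def)
  \<comment> \<open>Half of the bound in \<open>sum_Z\<close> is exactly the subtracted
    \<open>fact n\<close>; this is where the tangent at 2 pays off.\<close>
  also have "\<dots> \<le> fact n * (ln K / 2)" using sum_Z by simp
  finally have "ln K * (\<Sum>\<pi>\<in>perms. q \<pi>) \<le> ln K * (fact n / 2)"
    by (simp add: sum_distrib_left mult.commute)
  \<comment> \<open>Strict positivity lets \<open>ln K\<close> be cancelled, leaving an average
    success probability of at most 1/2.\<close>
  moreover have "ln K > 0"
  proof -
    have "2 \<le> K" using fact_mono[of 2 m, where 'a=real] m(1) by (simp add: K_def)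
    then show ?thesis by simp
  qed
  ultimately have sum_q: "(\<Sum>\<pi>\<in>perms. q \<pi>) \<le> fact n / 2" by simp

  \<comment> \<open>The average error is at least 1/2, and the supremum dominates the average; it is
    a genuine upper bound because \<open>perms\<close> is finite.\<close>
  have "fact n / 2 \<le> (\<Sum>\<pi>\<in>(perms :: ('n \<Rightarrow> 'n) set). err \<pi>)"
    using sum_q by (simp add: err sum_subtractf card_perms n_def)
  also have "\<dots> \<le> (\<Sum>\<pi>\<in>(perms :: ('n \<Rightarrow> 'n) set). SUP \<pi>\<in>perms. err \<pi>)"
    by (intro sum_mono cSUP_upper) auto
  also have "\<dots> = fact n * (SUP \<pi>\<in>perms. err \<pi>)"
    by (simp add: card_perms n_def)
  finally have "1 / 2 \<le> (SUP \<pi>\<in>perms. err \<pi>)"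
    by (simp add: field_simps)
  then show ?thesis by (simp add: err_def y_def)
qed

end
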